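(* For every fixed integer $k \ge 2$ there is a constant $c_2(k) > 0$ such that the almost balanced ordered biclique covering number $f(n,k)$ of order $k$ of the complete graph $K_n$ satisfies $$f(n,k) \;\le\; (1+o(1)) \cdot c_2(k) \cdot n^{\frac{1}{\lfloor k/2\rfloor + 1} + o(1)} ,$$ where each $o(1)$ denotes a quantity tending to $0$ as $n \to \infty$ with $k$ fixed.
   Context: A biclique $B=(U,W)$ in the complete graph $K_n$ is a complete bipartite subgraph given by an ordered pair of disjoint vertex sets: a first class $U$ and a second class $W$. It contains (covers) the edge $\{u,v\}$ if one of $u,v$ lies in $U$ and the other lies in $W$. For a positive integer $k$, an almost balanced ordered biclique covering of order $k$ of $K_n$ is a finite collection of bicliques $(U_1,W_1),\dots,(U_d,W_d)$ such that: (i) every edge of $K_n$ is contained in at least one and at most $k$ of the bicliques; (ii) for every edge $\{u,v\}$, the number of indices $i$ with $u\in U_i$, $v\in W_i$ and the number of indices $i$ with $v\in U_i$, $u\in W_i$ differ by at most one. The number $d$ is the size of the collection, and $f(n,k)$ is the minimum size of an almost balanced ordered biclique covering of order $k$ of $K_n$. *)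

theory Defs
  imports Complex_Main
begin

text \<open>The complete graph \<open>K\<^sub>n\<close> has vertex set \<open>{..<n}\<close>.\<close>

definition complete_graph_edges :: "nat \<Rightarrow> nat set set" where
  "complete_graph_edges n = {{u, v} |u v. u < n \<and> v < n \<and> u \<noteq> v}"

text \<open>A biclique is given by its ordered pair of classes. Empty classes are allowed:
  such a biclique covers no edge, so this does not affect the minimum size of a covering.\<close>

definition biclique :: "nat \<Rightarrow> nat set \<times> nat set \<Rightarrow> bool" where
  "biclique n B \<longleftrightarrow> fst B \<subseteq> {..<n} \<and> snd B \<subseteq> {..<n} \<and> fst B \<inter> snd B = {}"

definition covers_edge :: "nat set \<times> nat set \<Rightarrow> nat set \<Rightarrow> bool" where
  "covers_edge B e \<longleftrightarrow> (\<exists>u \<in> fst B. \<exists>v \<in> snd B. e = {u, v})"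

definition cover_count :: "(nat set \<times> nat set) list \<Rightarrow> nat set \<Rightarrow> nat" where
  "cover_count Bs e = card {i. i < length Bs \<and> covers_edge (Bs ! i) e}"

definition ordered_count :: "(nat set \<times> nat set) list \<Rightarrow> nat \<Rightarrow> nat \<Rightarrow> nat" where
  "ordered_count Bs u v = card {i. i < length Bs \<and> u \<in> fst (Bs ! i) \<and> v \<in> snd (Bs ! i)}"

text \<open>A collection is a list, so the same biclique may occur with several indices.\<close>

definition almost_balanced_covering ::
    "nat \<Rightarrow> nat \<Rightarrow> (nat set \<times> nat set) list \<Rightarrow> bool" where
  "almost_balanced_covering n k Bs \<longleftrightarrow>
     (\<forall>B \<in> set Bs. biclique n B) \<and>
     (\<forall>e \<in> complete_graph_edges n. 1 \<le> cover_count Bs e \<and> cover_count Bs e \<le> k) \<and>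
     (\<forall>u v. {u, v} \<in> complete_graph_edges n \<longrightarrow>
        \<bar>int (ordered_count Bs u v) - int (ordered_count Bs v u)\<bar> \<le> 1)"

definition covering_number :: "nat \<Rightarrow> nat \<Rightarrow> nat" where
  "covering_number n k = (LEAST d. \<exists>Bs. almost_balanced_covering n k Bs \<and> length Bs = d)"

text \<open>The minimum is attained: the stars with centre \<open>i\<close> and leaves \<open>i + 1, \<dots>, n - 1\<close>
  cover every edge exactly once.\<close>

lemma almost_balanced_covering_exists:
  assumes "1 \<le> k"
  shows "\<exists>Bs. almost_balanced_covering n k Bs"
proof -
  define Bs where "Bs = map (\<lambda>i. ({i}, {i<..<n})) [0..<n]"
  have len: "length Bs = n" by (simp add: Bs_def)
  have nth: "Bs ! i = ({i}, {i<..<n})" if "i < n" for i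
    using that by (simp add: Bs_def)
  have cnt: "cover_count Bs {u, v} = 1" if "u < v" "v < n" for u v
  proof -
    have "{i. i < length Bs \<and> covers_edge (Bs ! i) {u, v}} = {u}"
      using that by (auto simp: len nth covers_edge_def doubleton_eq_iff)
    then show ?thesis by (simp add: cover_count_def)
  qed
  have ord: "ordered_count Bs u v \<le> 1" for u v
  proof -
    have "{i. i < length Bs \<and> u \<in> fst (Bs ! i) \<and> v \<in> snd (Bs ! i)} \<subseteq> {u}"
      by (auto simp: len nth)
    from card_mono[OF _ this] show ?thesis by (simp add: ordered_count_def)
  qed
  have "1 \<le> cover_count Bs e \<and> cover_count Bs e \<le> k" if e: "e \<in> complete_graph_edges n" for e
  proof -
    obtain u v where uv: "e = {u, v}" "u < n" "v < n" "u \<noteq> v"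
      using e by (auto simp: complete_graph_edges_def)
    then have "cover_count Bs e = 1"
      using cnt[of u v] cnt[of v u] by (cases "u < v") (auto simp: insert_commute)
    then show ?thesis using assms by simp
  qed
  moreover have "\<bar>int (ordered_count Bs u v) - int (ordered_count Bs v u)\<bar> \<le> 1" for u v
    using ord[of u v] ord[of v u] by linarith
  moreover have "\<forall>B \<in> set Bs. biclique n B"
    by (auto simp: Bs_def biclique_def)
  ultimately show ?thesis
    unfolding almost_balanced_covering_def by blast
qed

end

(* Put m = k div 2 + 1 and let r and t be positive integers. A vertex is a tuple
   (y, a, z_1, ..., z_{m-2}) with y and the z_i in [t^r] and a in [t^(r-1)], so that there are
   t^(mr-1) of them.

   Each z_i is handled by the t^r bicliques ({z_i = c}, {z_i \<noteq> c}): two vertices with different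
   z_i are covered once in each direction, which does not affect the balance.

   It remains to cover the pairs that differ in (y, a), at most once in each direction, by
   O(r t^r) bicliques. Write y and a in base t. A relation between u and v that depends on u only
   through a function with N values costs N bicliques, so at a cost of t^r each we may ask that
   - digit l is the highest one where y differs, and a(u) \<ge> a(v) for the numbers formed by the
     l lowest digits, or
   - digit l is the highest one where a differs, it is smaller in u, and the l+1 lowest digits of
     y agree.
   These 2r-1 relations are pairwise disjoint and, \<ge> being total, one of them holds for (u, v) or
   for (v, u). Thus t^(mr-1) vertices need O(t^r) bicliques for fixed r, and r/(mr-1) tends to
   1/m as r grows. *)
theory Submission imports Defs begin

section \<open>Ordered counts and the bicliques that realize them\<close>

lemma ordered_count_append:
  "ordered_count (Bs @ Cs) u v = ordered_count Bs u v + ordered_count Cs u v"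
proof -
  let ?p = "\<lambda>B. u \<in> fst B \<and> v \<in> snd B"
  have "ordered_count Ds u v = length (filter ?p Ds)" for Ds
    by (simp add: ordered_count_def length_filter_conv_card)
  then show ?thesis by simp
qed

text \<open>The classes of a biclique are disjoint, so no index covers the edge in both directions
  and the two ordered counts add up.\<close>

lemma cover_count_eq_ordered_count:
  assumes "\<forall>B \<in> set Bs. biclique n B" "u \<noteq> v"
  shows "cover_count Bs {u, v} = ordered_count Bs u v + ordered_count Bs v u"
proof -
  let ?A = "\<lambda>u v. {i. i < length Bs \<and> u \<in> fst (Bs ! i) \<and> v \<in> snd (Bs ! i)}"
  have "{i. i < length Bs \<and> covers_edge (Bs ! i) {u, v}} = ?A u v \<union> ?A v u"
    by (auto simp: covers_edge_def doubleton_eq_iff)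
  moreover have "?A u v \<inter> ?A v u = {}"
  proof -
    have "fst (Bs ! i) \<inter> snd (Bs ! i) = {}" if "i < length Bs" for i
      using assms(1) that by (simp add: biclique_def)
    then show ?thesis by blast
  qed
  ultimately show ?thesis
    by (simp add: cover_count_def ordered_count_def card_Un_disjoint)
qed

text \<open>The counts are prescribed exactly while the length is only bounded, so that
  constructions can be added and their costs estimated separately.\<close>

definition realizable :: "nat \<Rightarrow> nat \<Rightarrow> (nat \<Rightarrow> nat \<Rightarrow> nat) \<Rightarrow> bool" where
  "realizable n d c \<longleftrightarrow> (\<exists>Bs. (\<forall>B \<in> set Bs. biclique n B) \<and> length Bs \<le> d \<and>
     (\<forall>u<n. \<forall>v<n. ordered_count Bs u v = c u v))"

lemma realizable_0: "realizable n 0 (\<lambda>u v. 0)"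
  unfolding realizable_def by (intro exI[of _ "[]"]) (simp add: ordered_count_def)

lemma realizable_add:
  assumes "realizable n d c" "realizable n d' c'"
  shows "realizable n (d + d') (\<lambda>u v. c u v + c' u v)"
proof -
  obtain Bs Cs where
    "\<forall>B \<in> set Bs. biclique n B" "length Bs \<le> d" "\<forall>u<n. \<forall>v<n. ordered_count Bs u v = c u v"
    "\<forall>B \<in> set Cs. biclique n B" "length Cs \<le> d'" "\<forall>u<n. \<forall>v<n. ordered_count Cs u v = c' u v"
    using assms unfolding realizable_def by blast
  then show ?thesis
    unfolding realizable_def by (intro exI[of _ "Bs @ Cs"]) (auto simp: ordered_count_append)
qed

lemma realizable_sum:
  assumes "finite I" "\<And>i. i \<in> I \<Longrightarrow> realizable n d (c i)"
  shows "realizable n (card I * d) (\<lambda>u v. \<Sum>i\<in>I. c i u v)"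
  using assms
proof (induction I rule: finite_induct)
  case empty
  then show ?case by (simp add: realizable_0)
next
  case (insert i I)
  then have "realizable n (d + card I * d) (\<lambda>u v. c i u v + (\<Sum>i\<in>I. c i u v))"
    by (intro realizable_add) auto
  with insert.hyps show ?case by simp
qed

text \<open>Take one biclique for each value p in \<open>G\<close>: its first class is the fibre of
  \<open>g\<close> over p, its second class the set of v with \<open>S p v\<close>. Only the
  biclique of p = \<open>g u\<close> can count (u, v), and \<open>irrefl\<close> makes the classes
  disjoint.\<close>

lemma realizable_relation:
  assumes G: "finite G" "\<And>u. u < n \<Longrightarrow> g u \<in> G" and irrefl: "\<And>u. u < n \<Longrightarrow> \<not> S (g u) u"
  shows "realizable n (card G) (\<lambda>u v. of_bool (S (g u) v))"
proof -
  obtain ps where ps: "set ps = G" "distinct ps"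
    using finite_distinct_list[OF G(1)] by blast
  define B where "B p = ({u. u < n \<and> g u = p}, {v. v < n \<and> S p v})" for p
  have "ordered_count (map B ps) u v = of_bool (S (g u) v)" if "u < n" "v < n" for u v
  proof -
    have "ordered_count (map B ps) u v = length (filter (\<lambda>p. p = g u \<and> S p v) ps)"
      using that unfolding ordered_count_def length_filter_conv_card
      by (intro arg_cong[of _ _ card]) (auto simp: B_def)
    also have "\<dots> = card {p \<in> set ps. p = g u \<and> S p v}"
      using ps(2) by (metis distinct_card distinct_filter set_filter)
    also have "{p \<in> set ps. p = g u \<and> S p v} = (if S (g u) v then {g u} else {})"
      using ps(1) G(2)[OF that(1)] by auto
    finally show ?thesis by simp
  qed
  moreover have "\<forall>B' \<in> set (map B ps). biclique n B'"
    using irrefl by (auto simp: B_def biclique_def)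
  moreover have "length (map B ps) = card G"
    using ps by (simp add: distinct_card[symmetric])
  ultimately show ?thesis
    unfolding realizable_def by (intro exI[of _ "map B ps"]) auto
qed

lemma realizable_mono: "realizable n d c \<Longrightarrow> d \<le> d' \<Longrightarrow> realizable n d' c"
  unfolding realizable_def by (meson le_trans)

text \<open>Both conditions on a covering can be read off from the ordered counts, so it is enough
  to prescribe these.\<close>

lemma covering_number_le_realizable:
  assumes "realizable n d c"
    and "\<And>u v. u < n \<Longrightarrow> v < n \<Longrightarrow> u \<noteq> v \<Longrightarrow>
      1 \<le> c u v + c v u \<and> c u v + c v u \<le> k \<and> \<bar>int (c u v) - int (c v u)\<bar> \<le> 1"
  shows "covering_number n k \<le> d"
proof -
  obtain Bs where Bs: "\<forall>B \<in> set Bs. biclique n B" "length Bs \<le> d"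
      "\<forall>u<n. \<forall>v<n. ordered_count Bs u v = c u v"
    using assms(1) unfolding realizable_def by blast
  have "almost_balanced_covering n k Bs"
    unfolding almost_balanced_covering_def
  proof (intro conjI ballI allI impI)
    fix B assume "B \<in> set Bs"
    then show "biclique n B" using Bs(1) by blast
  next
    fix e assume "e \<in> complete_graph_edges n"
    then obtain u v where e: "e = {u, v}" "u < n" "v < n" "u \<noteq> v"
      by (auto simp: complete_graph_edges_def)
    then have "cover_count Bs e = c u v + c v u"
      using cover_count_eq_ordered_count[OF Bs(1), of u v] Bs(3) by simp
    with assms(2)[of u v] e show "1 \<le> cover_count Bs e" "cover_count Bs e \<le> k" by simp_all
  next
    fix u v assume "{u, v} \<in> complete_graph_edges n"
    then have "u < n" "v < n" "u \<noteq> v"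
      by (auto simp: complete_graph_edges_def doubleton_eq_iff)
    then have "ordered_count Bs u v = c u v" "ordered_count Bs v u = c v u"
        "\<bar>int (c u v) - int (c v u)\<bar> \<le> 1"
      using Bs(3) assms(2)[of u v] by simp_all
    then show "\<bar>int (ordered_count Bs u v) - int (ordered_count Bs v u)\<bar> \<le> 1" by simp
  qed
  then have "covering_number n k \<le> length Bs"
    unfolding covering_number_def by (intro Least_le exI[of _ Bs] conjI refl)
  with Bs(2) show ?thesis by simp
qed

section \<open>Two families of relations on pairs (y, a) in base t\<close>

definition rel_fst :: "nat \<Rightarrow> nat \<Rightarrow> nat \<times> nat \<Rightarrow> nat \<times> nat \<Rightarrow> bool" where
  "rel_fst t l = (\<lambda>(y, a) (y', a'). y div t ^ Suc l = y' div t ^ Suc l \<and> y div t ^ l \<noteq> y' div t ^ l \<and>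
     a' mod t ^ l \<le> a mod t ^ l)"

definition rel_snd :: "nat \<Rightarrow> nat \<Rightarrow> nat \<times> nat \<Rightarrow> nat \<times> nat \<Rightarrow> bool" where
  "rel_snd t l = (\<lambda>(y, a) (y', a'). a div t ^ Suc l = a' div t ^ Suc l \<and> a div t ^ l < a' div t ^ l \<and>
     y mod t ^ Suc l = y' mod t ^ Suc l)"

text \<open>The quotients by \<open>t ^ l\<close> differ at l = 0 and are both 0 at l = r, so
  somewhere in between they pass from different to equal.\<close>

lemma exists_top_difference:
  fixes x y t :: nat
  assumes "x \<noteq> y" "x < t ^ r" "y < t ^ r"
  obtains l where "l < r" "x div t ^ Suc l = y div t ^ Suc l" "x div t ^ l \<noteq> y div t ^ l"
proof -
  have "\<exists>l<r. x div t ^ Suc l = y div t ^ Suc l \<and> x div t ^ l \<noteq> y div t ^ l"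
  proof (rule ccontr)
    assume *: "\<not> ?thesis"
    have "x div t ^ l \<noteq> y div t ^ l" if "l \<le> r" for l
      using that
    proof (induction l)
      case (Suc l)
      with * show ?case by auto
    qed (use assms(1) in simp)
    from this[of r] assms show False by simp
  qed
  with that show ?thesis by blast
qed

lemma div_power_eq_mono:
  fixes x y t :: nat
  assumes "x div t ^ l = y div t ^ l" "l \<le> m"
  shows "x div t ^ m = y div t ^ m"
proof -
  have "x div t ^ m = x div t ^ l div t ^ (m - l)" for x :: nat
    using assms(2) by (simp flip: div_mult2_eq power_add)
  with assms(1) show ?thesis by simp
qed

lemma mod_power_eq_mono:
  fixes x y t :: nat
  assumes "x mod t ^ m = y mod t ^ m" "l \<le> m"
  shows "x mod t ^ l = y mod t ^ l"
proof -
  have "x mod t ^ m mod t ^ l = x mod t ^ l" for x :: nat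
    using assms(2) by (intro mod_mod_cancel le_imp_power_dvd)
  from this[of x] this[of y] assms(1) show ?thesis by simp
qed

text \<open>Agreement above digit l persists at every higher level, which rules out a top difference
  at a larger index; the roles of the two indices are symmetric.\<close>

lemma rel_fst_unique:
  assumes "rel_fst t l p q" "rel_fst t m p q"
  shows "l = m"
proof -
  have "\<not> l < m" if "rel_fst t l p q" "rel_fst t m p q" for l m
  proof
    assume "l < m"
    moreover obtain y a y' a' where "p = (y, a)" "q = (y', a')" by (cases p, cases q)
    moreover note that
    ultimately show False
      using div_power_eq_mono[of y t "Suc l" y' m] by (simp add: rel_fst_def)
  qed
  with assms show ?thesis by (meson linorder_neqE_nat)
qed

lemma rel_snd_unique:
  assumes "rel_snd t l p q" "rel_snd t m p q"
  shows "l = m"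
proof -
  have "\<not> l < m" if "rel_snd t l p q" "rel_snd t m p q" for l m
  proof
    assume "l < m"
    moreover obtain y a y' a' where "p = (y, a)" "q = (y', a')" by (cases p, cases q)
    moreover note that
    ultimately show False
      using div_power_eq_mono[of a t "Suc l" a' m] by (simp add: rel_snd_def)
  qed
  with assms show ?thesis by (meson linorder_neqE_nat)
qed

text \<open>If m \<le> l, the digits of y agree up to position m and also above it, so y = y'. If l
  < m, the digits of a from m upward agree, so comparing the m lowest ones yields a' \<le> a,
  whereas \<open>rel_snd\<close> forces a < a'.\<close>

lemma rel_fst_rel_snd_disjoint:
  assumes "rel_snd t l p q" "rel_fst t m p q"
  shows False
proof -
  obtain y a y' a' where pq: "p = (y, a)" "q = (y', a')" by (cases p, cases q)
  have P: "a div t ^ Suc l = a' div t ^ Suc l" "a div t ^ l < a' div t ^ l"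
      "y mod t ^ Suc l = y' mod t ^ Suc l"
    and Q: "y div t ^ Suc m = y' div t ^ Suc m" "y div t ^ m \<noteq> y' div t ^ m"
      "a' mod t ^ m \<le> a mod t ^ m"
    using assms by (simp_all add: rel_snd_def rel_fst_def pq del: power_Suc)
  show False
  proof (cases "m \<le> l")
    case True
    then have "y mod t ^ Suc m = y' mod t ^ Suc m"
      using mod_power_eq_mono[OF P(3), of "Suc m"] by simp
    with Q(1) have "y = y'"
      using div_mult_mod_eq[of y "t ^ Suc m"] div_mult_mod_eq[of y' "t ^ Suc m"] by simp
    with Q(2) show False by simp
  next
    case False
    then have "a div t ^ m = a' div t ^ m"
      using div_power_eq_mono[OF P(1), of m] by simp
    with Q(3) have "a' \<le> a"
      using div_mult_mod_eq[of a "t ^ m"] div_mult_mod_eq[of a' "t ^ m"] by simp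
    with P(2) div_le_mono[of a' a "t ^ l"] show False by simp
  qed
qed

text \<open>If y and y' differ, the low parts of a and a' are comparable in one of the two orders.
  If y = y', the condition on y in \<open>rel_snd\<close> is automatic and the top difference of a
  orients the pair.\<close>

lemma exists_rel_fst_or_rel_snd:
  assumes "(y, a) \<noteq> (y', a')" "y < t ^ r" "y' < t ^ r" "a < t ^ (r - 1)" "a' < t ^ (r - 1)"
  shows "(\<exists>l<r. rel_fst t l (y, a) (y', a') \<or> rel_fst t l (y', a') (y, a)) \<or>
    (\<exists>l<r - 1. rel_snd t l (y, a) (y', a') \<or> rel_snd t l (y', a') (y, a))"
proof (cases "y = y'")
  case False
  then obtain l where "l < r" "y div t ^ Suc l = y' div t ^ Suc l" "y div t ^ l \<noteq> y' div t ^ l"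
    using exists_top_difference assms(2,3) by blast
  then have "rel_fst t l (y, a) (y', a') \<or> rel_fst t l (y', a') (y, a)"
    unfolding rel_fst_def using nle_le by auto
  with \<open>l < r\<close> show ?thesis by blast
next
  case True
  then obtain l where "l < r - 1" "a div t ^ Suc l = a' div t ^ Suc l" "a div t ^ l \<noteq> a' div t ^ l"
    using exists_top_difference assms(1,4,5) by blast
  then have "rel_snd t l (y, a) (y', a') \<or> rel_snd t l (y', a') (y, a)"
    unfolding rel_snd_def using True by auto
  with \<open>l < r - 1\<close> show ?thesis by blast
qed

text \<open>Digit s and the quotient at level s + 1 together determine the quotient at level s, so
  equality descends to level 0.\<close>

lemma eq_if_digits_eq:
  fixes u v T :: nat
  assumes "\<And>i. i < s \<Longrightarrow> u div T ^ i mod T = v div T ^ i mod T" "u div T ^ s = v div T ^ s"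
  shows "u = v"
  using assms
proof (induction s)
  case 0
  from 0(2) show ?case by simp
next
  case (Suc s)
  have "u div T ^ s div T = v div T ^ s div T"
    using Suc.prems(2) by (simp only: power_Suc2 div_mult2_eq)
  moreover have "u div T ^ s mod T = v div T ^ s mod T"
    by (rule Suc.prems(1)) simp
  ultimately have "u div T ^ s = v div T ^ s"
    using div_mult_mod_eq[of "u div T ^ s" T] div_mult_mod_eq[of "v div T ^ s" T] by argo
  then show ?case
    by (rule Suc.IH[rotated]) (rule Suc.prems(1), simp only: less_SucI)
qed

text \<open>Written as a sum of indicators so that its cost follows from the additivity of
  \<open>realizable\<close>.\<close>

definition rel_count :: "nat \<Rightarrow> nat \<Rightarrow> nat \<times> nat \<Rightarrow> nat \<times> nat \<Rightarrow> nat" where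
  "rel_count t r p q = (\<Sum>l<r. of_bool (rel_fst t l p q)) + (\<Sum>l<r - 1. of_bool (rel_snd t l p q))"

lemma sum_of_bool_le_1:
  assumes "finite I" "\<And>i j. i \<in> I \<Longrightarrow> j \<in> I \<Longrightarrow> X i \<Longrightarrow> X j \<Longrightarrow> i = j"
  shows "(\<Sum>i\<in>I. of_bool (X i)) \<le> (1::nat)"
proof -
  have "(\<Sum>i\<in>I. of_bool (X i)) = card (I \<inter> Collect X)"
    using assms(1) by simp
  also have "\<dots> \<le> 1"
    using assms by (auto simp: card_le_Suc0_iff_eq)
  finally show ?thesis .
qed

lemma rel_count_le_1: "rel_count t r p q \<le> 1"
proof (cases "\<exists>l. rel_fst t l p q")
  case True
  then have "\<not> rel_snd t l p q" for l using rel_fst_rel_snd_disjoint by blast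
  then show ?thesis
    unfolding rel_count_def
    using sum_of_bool_le_1[of "{..<r}" "\<lambda>l. rel_fst t l p q"] rel_fst_unique[of t _ p q] by auto
next
  case False
  then show ?thesis
    unfolding rel_count_def
    using sum_of_bool_le_1[of "{..<r - 1}" "\<lambda>l. rel_snd t l p q"] rel_snd_unique[of t _ p q] by auto
qed

lemma rel_count_total:
  assumes "(y, a) \<noteq> (y', a')" "y < t ^ r" "y' < t ^ r" "a < t ^ (r - 1)" "a' < t ^ (r - 1)"
  shows "1 \<le> rel_count t r (y, a) (y', a') + rel_count t r (y', a') (y, a)"
proof -
  have pos: "1 \<le> (\<Sum>l<s. of_bool (X l) :: nat)" if "l < s" "X l" for l s :: nat and X
  proof -
    have "of_bool (X l) \<le> (\<Sum>l<s. of_bool (X l) :: nat)"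
      using that by (intro member_le_sum) auto
    with that show ?thesis by simp
  qed
  from exists_rel_fst_or_rel_snd[OF assms] show ?thesis
    unfolding rel_count_def by (elim disjE exE conjE) (drule (1) pos, linarith)+
qed

section \<open>The cost of the relations in bicliques\<close>

lemma realizable_rel_fst:
  assumes "l < r" "0 < t" "\<And>u. u < n \<Longrightarrow> y u < t ^ r"
  shows "realizable n (t ^ r) (\<lambda>u v. of_bool (rel_fst t l (y u, a u) (y v, a v)))"
proof -
  \<comment> \<open>The first pair enters only through the digits of y from l upward and the l
    lowest digits of a: (r - l) + l = r digits in all.\<close>
  let ?G = "{..<t ^ (r - l)} \<times> {..<t ^ l}"
  let ?S = "\<lambda>(b, e) v. b div t = y v div t ^ Suc l \<and> b \<noteq> y v div t ^ l \<and> a v mod t ^ l \<le> e"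
  have "realizable n (card ?G) (\<lambda>u v. of_bool (?S (y u div t ^ l, a u mod t ^ l) v))"
  proof (rule realizable_relation)
    fix u assume "u < n"
    then have "y u < t ^ (r - l) * t ^ l"
      using assms by (simp flip: power_add)
    with assms(2) show "(y u div t ^ l, a u mod t ^ l) \<in> ?G"
      by (simp add: less_mult_imp_div_less)
  qed simp_all
  moreover have "card ?G = t ^ r"
    using assms(1) by (simp flip: power_add)
  moreover have "y u div t ^ l div t = y u div t ^ Suc l" for u
    by (simp only: power_Suc2 div_mult2_eq)
  ultimately show ?thesis by (simp add: rel_fst_def del: power_Suc)
qed

text \<open>Here l + 1 low digits of y are read; since a has only r - 1 digits, the total is again
  (r - 1 - l) + (l + 1) = r.\<close>

lemma realizable_rel_snd:
  assumes "l < r - 1" "0 < t" "\<And>u. u < n \<Longrightarrow> a u < t ^ (r - 1)"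
  shows "realizable n (t ^ r) (\<lambda>u v. of_bool (rel_snd t l (y u, a u) (y v, a v)))"
proof -
  let ?G = "{..<t ^ (r - 1 - l)} \<times> {..<t ^ Suc l}"
  let ?S = "\<lambda>(b, e) v. b div t = a v div t ^ Suc l \<and> b < a v div t ^ l \<and> e = y v mod t ^ Suc l"
  have "realizable n (card ?G) (\<lambda>u v. of_bool (?S (a u div t ^ l, y u mod t ^ Suc l) v))"
  proof (rule realizable_relation)
    fix u assume "u < n"
    then have "a u < t ^ (r - 1 - l) * t ^ l"
      using assms by (simp flip: power_add)
    with assms(2) show "(a u div t ^ l, y u mod t ^ Suc l) \<in> ?G"
      by (simp add: less_mult_imp_div_less)
  qed simp_all
  moreover have "card ?G = t ^ r"
    using assms(1) by (simp del: power_Suc flip: power_add)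
  moreover have "a u div t ^ l div t = a u div t ^ Suc l" for u
    by (simp only: power_Suc2 div_mult2_eq)
  ultimately show ?thesis by (simp add: rel_snd_def del: power_Suc)
qed

lemma realizable_rel_count:
  assumes "1 \<le> r" "0 < t" "\<And>u. u < n \<Longrightarrow> y u < t ^ r" "\<And>u. u < n \<Longrightarrow> a u < t ^ (r - 1)"
  shows "realizable n (2 * r * t ^ r) (\<lambda>u v. rel_count t r (y u, a u) (y v, a v))"
proof -
  have "realizable n (card {..<r} * t ^ r + card {..<r - 1} * t ^ r)
      (\<lambda>u v. rel_count t r (y u, a u) (y v, a v))"
    unfolding rel_count_def using assms
    by (intro realizable_add realizable_sum realizable_rel_fst realizable_rel_snd) auto
  then show ?thesis
    by (rule realizable_mono) (simp add: add_mult_distrib mult_2)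
qed

section \<open>The covering for n up to a power of t\<close>

lemma covering_number_le:
  assumes k: "2 \<le> k" and r: "1 \<le> r" and t: "0 < t" and n: "n \<le> t ^ (Suc (k div 2) * r - 1)"
  shows "covering_number n k \<le> (2 * r + k) * t ^ r"
proof -
  \<comment> \<open>A vertex u is read in base \<open>T\<close>: digit 0 is y, the digits 1, ..., s
    - 1 are the z_i, and the remaining quotient by \<open>T ^ s\<close> is a.\<close>
  define s where "s = k div 2"
  define T where "T = t ^ r"
  define digit where "digit i u = u div T ^ i mod T" for i u :: nat
  define a where "a u = u div T ^ s" for u
  have s: "1 \<le> s" "2 * s \<le> k" using k by (simp_all add: s_def)
  have T: "0 < T" using t by (simp add: T_def)
  have digit: "digit i u < t ^ r" for i u
    using T by (simp add: digit_def T_def)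
  \<comment> \<open>The exponent splits into s blocks of r base-t digits and r - 1 further digits
    for \<open>a\<close>.\<close>
  have "Suc s * r - 1 = (r - 1) + r * s" using r by (simp add: mult.commute)
  with n have "n \<le> t ^ (r - 1) * T ^ s"
    by (simp add: s_def T_def power_add power_mult)
  then have a: "a u < t ^ (r - 1)" if "u < n" for u
    using that unfolding a_def by (intro less_mult_imp_div_less) simp
  \<comment> \<open>\<open>D\<close> is symmetric in u and v, so any imbalance of \<open>c\<close>
    comes from \<open>rel_count\<close> alone.\<close>
  define D where "D u v = (\<Sum>i\<in>{1..<s}. of_bool (digit i u \<noteq> digit i v) :: nat)" for u v
  define c where "c u v = rel_count t r (digit 0 u, a u) (digit 0 v, a v) + D u v" for u v
  have "realizable n (t ^ r) (\<lambda>u v. of_bool (digit i u \<noteq> digit i v))" for i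
    using realizable_relation[of "{..<t ^ r}" n "digit i" "\<lambda>b v. b \<noteq> digit i v"] digit by simp
  then have "realizable n (2 * r * t ^ r + card {1..<s} * t ^ r) c"
    unfolding c_def D_def using r t a digit
    by (intro realizable_add realizable_sum realizable_rel_count) auto
  moreover have "2 * r * t ^ r + card {1..<s} * t ^ r \<le> (2 * r + k) * t ^ r"
  proof -
    have "card {1..<s} \<le> k" using s by simp
    then show ?thesis by (simp only: add_mult_distrib mult_le_mono1 add_left_mono)
  qed
  ultimately have "realizable n ((2 * r + k) * t ^ r) c"
    by (rule realizable_mono)
  then show ?thesis
  proof (rule covering_number_le_realizable)
    fix u v assume uv: "u < n" "v < n" "u \<noteq> v"
    let ?p = "(digit 0 u, a u)" and ?q = "(digit 0 v, a v)"
    have sym: "D v u = D u v"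
      unfolding D_def by (intro sum.cong) auto
    have "D u v \<le> (\<Sum>i\<in>{1..<s}. 1)"
      unfolding D_def by (intro sum_mono) simp
    then have D_le: "D u v \<le> s - 1" by simp
    have R_le: "rel_count t r ?p ?q \<le> 1" "rel_count t r ?q ?p \<le> 1"
      by (rule rel_count_le_1)+
    have "1 \<le> c u v + c v u"
    proof (cases "?p = ?q")
      case False
      with uv have "1 \<le> rel_count t r ?p ?q + rel_count t r ?q ?p"
        by (intro rel_count_total digit a)
      then show ?thesis by (simp add: c_def)
    next
      \<comment> \<open>Here y and a coincide, so equality of all z_i would force u = v.\<close>
      case True
      have "\<exists>i\<in>{1..<s}. digit i u \<noteq> digit i v"
      proof (rule ccontr)
        assume "\<not> ?thesis"
        with True have "digit i u = digit i v" if "i < s" for i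
          using that by (cases i) auto
        with True have "u = v"
          by (intro eq_if_digits_eq[of s u T v]) (auto simp: digit_def a_def)
        with uv(3) show False by simp
      qed
      then have "D u v \<noteq> 0" by (auto simp: D_def)
      then show ?thesis by (simp add: c_def)
    qed
    \<comment> \<open>The total is at most 2 + 2 (s - 1) = 2 s; s \<ge> 1 makes the natural
      subtraction exact.\<close>
    moreover have "c u v + c v u \<le> k"
      using D_le R_le s sym by (simp add: c_def)
    moreover have "\<bar>int (c u v) - int (c v u)\<bar> \<le> 1"
      using R_le sym by (simp add: c_def)
    ultimately show "1 \<le> c u v + c v u \<and> c u v + c v u \<le> k \<and> \<bar>int (c u v) - int (c v u)\<bar> \<le> 1"
      by blast
  qed
qed

section \<open>Asymptotics in n\<close>

lemma covering_number_powr_le: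
  assumes k: "2 \<le> k" and r: "1 \<le> r" and n: "1 \<le> n"
  shows "real (covering_number n k)
    \<le> (2 * real r + real k) * 2 ^ r * real n powr (real r / ((real (k div 2) + 1) * real r - 1))"
proof -
  define N where "N = Suc (k div 2) * r - 1"
  have "2 * 1 \<le> Suc (k div 2) * r" using k r by (intro mult_le_mono) auto
  then have N: "1 \<le> N" by (simp add: N_def)
  have N_real: "real N = (real (k div 2) + 1) * real r - 1"
    using r by (simp add: N_def of_nat_diff algebra_simps)
  define x where "x = real n powr (1 / real N)"
  have x: "1 \<le> x" using n by (simp add: x_def ge_one_powr_ge_zero)
  have x_power: "x ^ j = real n powr (real j / real N)" for j
    using x n by (simp add: x_def powr_powr flip: powr_realpow)
  \<comment> \<open>As x \<ge> 1, rounding up at most doubles it; this is the source of the factor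
    \<open>2 ^ r\<close>.\<close>
  define t where "t = nat \<lceil>x\<rceil>"
  have t: "x \<le> real t" "real t \<le> 2 * x" "0 < t"
    using x by (simp_all add: t_def) linarith+
  have "real n = x ^ N" using x_power[of N] N n by simp
  also have "\<dots> \<le> real t ^ N" using t(1) x by (intro power_mono) auto
  finally have "n \<le> t ^ N" by (simp flip: of_nat_power)
  then have "covering_number n k \<le> (2 * r + k) * t ^ r"
    using covering_number_le[OF k r t(3)] by (simp add: N_def)
  then have "real (covering_number n k) \<le> real ((2 * r + k) * t ^ r)"
    by (rule of_nat_mono)
  also have "\<dots> = (2 * real r + real k) * real t ^ r" by simp
  also have "\<dots> \<le> (2 * real r + real k) * (2 * x) ^ r"
    using t(2) by (intro mult_left_mono power_mono) auto
  also have "\<dots> = (2 * real r + real k) * 2 ^ r * real n powr (real r / real N)"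
    by (simp add: power_mult_distrib x_power)
  finally show ?thesis by (simp add: N_real)
qed

text \<open>The final estimate divides by \<open>ln n\<close>, which vanishes at n = 1, so this
  value is treated apart.\<close>

lemma covering_number_1: "covering_number 1 k = 0"
proof -
  have "almost_balanced_covering 1 k []"
    by (auto simp: almost_balanced_covering_def complete_graph_edges_def doubleton_eq_iff)
  then have "covering_number 1 k \<le> 0"
    unfolding covering_number_def by (intro Least_le exI[of _ "[]"]) simp
  then show ?thesis by simp
qed

theorem theorem2:
  fixes k :: nat
  assumes "2 \<le> k"
  shows "\<exists>c::real. 0 < c \<and>
    (\<exists>a b :: nat \<Rightarrow> real. a \<longlonglongrightarrow> 0 \<and> b \<longlonglongrightarrow> 0 \<and>
      (\<forall>n\<ge>1. real (covering_number n k)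
         \<le> (1 + a n) * c * real n powr (1 / (real (k div 2) + 1) + b n)))"
proof -
  define f where "f n = real (covering_number n k)" for n
  define m where "m = real (k div 2) + 1"
  \<comment> \<open>The exponent absorbs every error, so the constant can be 1 and the factor error
    0. For n \<ge> 2 and f n > 0 this is the least nonnegative correction that makes the bound hold;
    being nonnegative, it only needs an upper estimate to tend to 0.\<close>
  define b where "b n = max 0 (ln (f n) / ln (real n) - 1 / m)" for n
  have "1 \<le> k div 2" using assms by simp
  then have m: "2 \<le> m" unfolding m_def by linarith
  have b_less: "eventually (\<lambda>n. b n < e) sequentially" if e: "0 < e" for e
  proof -
    \<comment> \<open>Half of e pays for stopping at a finite r, since r / (m r - 1) exceeds 1 / m
      by at most 1 / r. The other half pays for the constant \<open>C\<close>, which is fixed once r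
      is chosen, as n grows.\<close>
    obtain j where j: "inverse (real (Suc j)) < e / 2"
      using reals_Archimedean[of "e / 2"] e by auto
    define r where "r = real (Suc j)"
    have r: "1 \<le> r" "1 / r < e / 2" using j by (simp_all add: r_def inverse_eq_divide)
    define C where "C = (2 * r + real k) * 2 ^ Suc j"
    have C: "0 < C" using r(1) by (simp add: C_def add_pos_nonneg)
    have "2 * r \<le> m * r" using m r(1) by (intro mult_right_mono) auto
    then have mr: "r \<le> m * r - 1" using r(1) by linarith
    have "r / (m * r - 1) - 1 / m = 1 / (m * (m * r - 1))"
      using m mr r(1) by (simp add: field_simps)
    also have "\<dots> \<le> 1 / r"
    proof (rule divide_left_mono)
      have "1 * r \<le> m * (m * r - 1)" using m mr r(1) by (intro mult_mono) auto
      then show "r \<le> m * (m * r - 1)" by simp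
      show "0 < m * (m * r - 1) * r" using m mr r(1) by (intro mult_pos_pos) linarith+
    qed simp
    finally have exponent: "r / (m * r - 1) - 1 / m < e / 2"
      using r(2) by (rule le_less_trans)
    have "((\<lambda>n. ln C / ln (real n)) \<longlongrightarrow> 0) sequentially"
      by (intro real_tendsto_divide_at_top[OF tendsto_const]
          filterlim_compose[OF ln_at_top filterlim_real_sequentially])
    then have "eventually (\<lambda>n. ln C / ln (real n) < e / 2) sequentially"
      using e by (intro order_tendstoD(2)) auto
    then show ?thesis
      using eventually_ge_at_top[of 2]
    proof eventually_elim
      case (elim n)
      have ln_n: "0 < ln (real n)" using elim(2) by simp
      have "ln (f n) / ln (real n) - 1 / m < e"
      proof (cases "f n = 0")
        \<comment> \<open>By convention \<open>ln 0 = 0\<close>, so the quotient of logarithms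
          vanishes.\<close>
        case True
        have "0 < 1 / m" using m by simp
        with e have "0 - 1 / m < e" by linarith
        with True show ?thesis by simp
      next
        case False
        then have "0 < f n" by (simp add: f_def)
        have "f n \<le> C * real n powr (r / (m * r - 1))"
          using covering_number_powr_le[OF assms, of "Suc j" n] elim(2)
          by (simp add: f_def C_def r_def m_def)
        with \<open>0 < f n\<close> have "ln (f n) \<le> ln (C * real n powr (r / (m * r - 1)))"
          by (intro ln_mono)
        also have "\<dots> = ln C + r / (m * r - 1) * ln (real n)"
          using C elim(2) by (simp add: ln_mult ln_powr)
        finally have "ln (f n) / ln (real n) \<le> ln C / ln (real n) + r / (m * r - 1)"
          using ln_n by (simp add: field_simps)
        with elim(1) exponent show ?thesis by linarith
      qed
      with e show ?case by (simp add: b_def)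
    qed
  qed
  have "b \<longlonglongrightarrow> 0"
  proof (rule order_tendstoI)
    fix x :: real assume "x < 0"
    then show "eventually (\<lambda>n. x < b n) sequentially"
      by (simp add: b_def less_max_iff_disj)
  qed (rule b_less)
  moreover have "f n \<le> (1 + 0) * 1 * real n powr (1 / m + b n)" if n: "1 \<le> n" for n
  proof (cases "n = 1 \<or> f n = 0")
    case True
    then show ?thesis using covering_number_1[of k] by (auto simp: f_def)
  next
    case False
    then have ln_n: "0 < ln (real n)" and "0 < f n" using n by (auto simp: f_def)
    have "f n = real n powr (ln (f n) / ln (real n))"
      using \<open>0 < f n\<close> ln_n n by (simp add: powr_def)
    also have "\<dots> \<le> real n powr (1 / m + b n)"
      using n by (intro powr_mono) (auto simp: b_def)
    finally show ?thesis by simp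
  qed
  ultimately show ?thesis
    unfolding f_def m_def
    by (intro exI[of _ "1::real"] conjI exI[of _ "\<lambda>_. 0::real"] exI[of _ b]) auto
qed

end
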